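(* If $k\ge 2$ and $G$ is a connected graph with $\mu(G)=\mu_i(G)$, then $\mu(K_k\,\square\, G)=k\cdot\mu(G)$.
   Context: All graphs are finite, simple, undirected. For $X\subseteq V(G)$, two vertices $x,y\in X$ are $X$-visible if there is a shortest $x,y$-path $P$ in $G$ with $V(P)\cap X=\{x,y\}$; $X$ is a mutual-visibility set if all pairs of its vertices are $X$-visible. $\mu(G)$ is the largest size of a mutual-visibility set of $G$; $\mu_i(G)$ is the largest size of a mutual-visibility set that is an independent set. $K_k$ is the complete graph on $k$ vertices, and $G\,\square\, H$ is the Cartesian product (vertex set $V(G)\times V(H)$, $(g,h)\sim(g',h')$ iff ($gg'\in E(G)$ and $h=h'$) or ($g=g'$ and $hh'\in E(H)$)). *)

theory Defs
  imports "Graph_Theory.Graph_Theory"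
begin

text \<open>
  Finite simple undirected graphs are \<^locale>\<open>pair_graph\<close>s: finite, loop-free, symmetric
  arc sets without parallel arcs, every edge being represented by its two opposite arcs.
\<close>

definition shortest_path :: "'a pair_pre_digraph \<Rightarrow> 'a \<Rightarrow> ('a \<times> 'a) awalk \<Rightarrow> 'a \<Rightarrow> bool" where
  "shortest_path G x p y \<longleftrightarrow>
     pre_digraph.apath (with_proj G) x p y \<and>
     (\<forall>q. pre_digraph.apath (with_proj G) x q y \<longrightarrow> length p \<le> length q)"

definition visible :: "'a pair_pre_digraph \<Rightarrow> 'a set \<Rightarrow> 'a \<Rightarrow> 'a \<Rightarrow> bool" where
  "visible G X x y \<longleftrightarrow>
     (\<exists>p. shortest_path G x p y \<and>
          set (pre_digraph.awalk_verts (with_proj G) x p) \<inter> X = {x, y})"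

definition mutual_visibility_set :: "'a pair_pre_digraph \<Rightarrow> 'a set \<Rightarrow> bool" where
  "mutual_visibility_set G X \<longleftrightarrow>
     X \<subseteq> pverts G \<and> (\<forall>x\<in>X. \<forall>y\<in>X. x \<noteq> y \<longrightarrow> visible G X x y)"

definition independent_vertex_set :: "'a pair_pre_digraph \<Rightarrow> 'a set \<Rightarrow> bool" where
  "independent_vertex_set G X \<longleftrightarrow>
     X \<subseteq> pverts G \<and> (\<forall>x\<in>X. \<forall>y\<in>X. (x, y) \<notin> parcs G)"

text \<open>For finite graphs both maxima range over a finite set containing \<open>card {} = 0\<close>.\<close>

definition mutual_visibility_number :: "'a pair_pre_digraph \<Rightarrow> nat" where
  "mutual_visibility_number G = Max {card X |X. mutual_visibility_set G X}"

definition independent_mutual_visibility_number :: "'a pair_pre_digraph \<Rightarrow> nat" where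
  "independent_mutual_visibility_number G =
     Max {card X |X. mutual_visibility_set G X \<and> independent_vertex_set G X}"

definition cartesian_product ::
    "'a pair_pre_digraph \<Rightarrow> 'b pair_pre_digraph \<Rightarrow> ('a \<times> 'b) pair_pre_digraph"
    (infixr \<open>\<box>\<close> 70) where
  "G \<box> H = \<lparr> pverts = pverts G \<times> pverts H,
     parcs = {((g, h), (g', h')) | g h g' h'.
                ((g, g') \<in> parcs G \<and> h = h' \<and> h \<in> pverts H) \<or>
                (g = g' \<and> g \<in> pverts G \<and> (h, h') \<in> parcs H)} \<rparr>"

lemma pair_graph_cartesian_product:
  assumes "pair_graph G" "pair_graph H"
  shows "pair_graph (G \<box> H)"
proof -
  interpret G: pair_graph G by fact
  interpret H: pair_graph H by fact
  have sub: "parcs (G \<box> H) \<subseteq> pverts (G \<box> H) \<times> pverts (G \<box> H)"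
    by (auto simp: cartesian_product_def dest: G.in_arcsD1 G.in_arcsD2 H.in_arcsD1 H.in_arcsD2)
  have fin: "finite (pverts (G \<box> H))"
    by (simp add: cartesian_product_def)
  show ?thesis
  proof
    show "finite (parcs (G \<box> H))"
      using sub fin by (meson finite_SigmaI finite_subset)
    show "symmetric (with_proj (G \<box> H))"
      by (auto simp: symmetric_def sym_def cartesian_product_def
          intro: G.arcs_symmetric H.arcs_symmetric)
  next
    fix e assume "e \<in> parcs (G \<box> H)"
    then show "fst e \<noteq> snd e"
      by (auto simp: cartesian_product_def dest: G.no_loops' H.no_loops')
  qed (use sub fin in auto)
qed

end

theory Submission
  imports Defs
begin

text \<open>
  A shortest path of \<open>K \<box> G\<close> between two vertices of one layer \<open>{i} \<times> V(G)\<close> stays in that layer,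
  since projecting to \<open>G\<close> discards the arcs of \<open>K\<close>. Hence a mutual-visibility set of \<open>K \<box> G\<close> meets
  every layer in (a copy of) a mutual-visibility set of \<open>G\<close>, which gives the upper bound.
  For the lower bound let \<open>S\<close> be a maximum mutual-visibility set of \<open>G\<close> that is independent. Then
  \<open>V(K) \<times> S\<close> is a mutual-visibility set: if \<open>x \<noteq> y\<close> are in \<open>S\<close>, then a shortest path from \<open>x\<close> to \<open>y\<close>
  realizing visibility has a second vertex \<open>v \<noteq> y\<close>, so \<open>v \<notin> S\<close>, and the step from layer \<open>i\<close> to
  layer \<open>j\<close> can be made at \<open>v\<close>.
\<close>

section \<open>Walks and shortest paths\<close>

lemma awalk_with_proj_iff:
  "pre_digraph.awalk (with_proj G) x p y \<longleftrightarrow> x \<in> pverts G \<and> set p \<subseteq> parcs G \<and> pcas x p y"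
  by (simp add: pre_digraph.awalk_def cas_with_proj_eq)

lemma (in wf_digraph) awalk_not_distinct_shorten:
  assumes "awalk u p v" "\<not> distinct (awalk_verts u p)"
  obtains q where "awalk u q v" "length q < length p"
proof -
  obtain q r s w where "p = q @ r @ s" "0 < length r" "awalk u q w" "awalk w s v"
    using awalk_not_distinct_decomp[OF assms] by blast
  then show ?thesis
    using that[of "q @ s"] awalk_appendI by fastforce
qed

lemma (in wf_digraph) awalk_apath_le:
  assumes "awalk u p v"
  obtains q where "apath u q v" "length q \<le> length p"
  using assms
proof (induction "length p" arbitrary: p thesis rule: less_induct)
  case less
  show ?case
  proof (cases "distinct (awalk_verts u p)")
    case True
    then show ?thesis using less.prems by (auto simp: apath_def)
  next
    case False
    then obtain q where "awalk u q v" "length q < length p"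
      using less.prems awalk_not_distinct_shorten by blast
    then obtain r where "apath u r v" "length r \<le> length q"
      using less.hyps by blast
    then show ?thesis using less.prems(1)[of r] \<open>length q < length p\<close> by linarith
  qed
qed

text \<open>A walk with a repeated vertex can be shortened by cutting out a closed subwalk, so
  minimal walks are paths. Distinctness thus need not be checked for projected walks, which may
  revisit vertices.\<close>

lemma shortest_path_iff:
  assumes "wf_digraph (with_proj G)"
  shows "shortest_path G x p y \<longleftrightarrow>
    pre_digraph.awalk (with_proj G) x p y \<and>
    (\<forall>q. pre_digraph.awalk (with_proj G) x q y \<longrightarrow> length p \<le> length q)"
proof -
  interpret wf_digraph "with_proj G" by fact
  have "apath x p y" if p: "awalk x p y" "\<forall>q. awalk x q y \<longrightarrow> length p \<le> length q"
  proof (rule ccontr)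
    assume "\<not> apath x p y"
    then have "\<not> distinct (awalk_verts x p)"
      using p(1) by (simp add: apath_def)
    then obtain q where "awalk x q y" "length q < length p"
      using awalk_not_distinct_shorten[OF p(1)] by blast
    then show False using p(2) by (simp add: leD)
  qed
  moreover have "length p \<le> length q"
    if q: "\<forall>q. apath x q y \<longrightarrow> length p \<le> length q" "awalk x q y" for q
  proof -
    obtain r where "apath x r y" "length r \<le> length q"
      using awalk_apath_le[OF q(2)] by blast
    then show ?thesis using q(1) order_trans by blast
  qed
  ultimately show ?thesis
    unfolding shortest_path_def using awalkI_apath by blast
qed

lemma pawalk_verts_last: "pcas x p y \<Longrightarrow> y \<in> set (pawalk_verts x p)"
  by (induction p arbitrary: x) auto

section \<open>Projection to a factor and embedding of a layer\<close>

lemma pverts_cartesian_product: "pverts (K \<box> G) = pverts K \<times> pverts G"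
  by (simp add: cartesian_product_def)

lemma parcs_cartesian_product_iff:
  "((i, x), (j, y)) \<in> parcs (K \<box> G) \<longleftrightarrow>
    (i, j) \<in> parcs K \<and> x = y \<and> x \<in> pverts G \<or> i = j \<and> i \<in> pverts K \<and> (x, y) \<in> parcs G"
  by (auto simp: cartesian_product_def)

definition layer_walk :: "'b \<Rightarrow> ('a \<times> 'a) awalk \<Rightarrow> (('b \<times> 'a) \<times> ('b \<times> 'a)) awalk" where
  "layer_walk i p = map (\<lambda>(x, y). ((i, x), (i, y))) p"

text \<open>Arcs that change the layer would project to loops, so they are dropped before
  mapping.\<close>

definition proj_walk :: "(('b \<times> 'a) \<times> ('b \<times> 'a)) awalk \<Rightarrow> ('a \<times> 'a) awalk" where
  "proj_walk p = map (\<lambda>(u, v). (snd u, snd v)) (filter (\<lambda>(u, v). fst u = fst v) p)"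

lemma length_layer_walk [simp]: "length (layer_walk i p) = length p"
  by (simp add: layer_walk_def)

lemma length_proj_walk_le: "length (proj_walk p) \<le> length p"
  by (simp add: proj_walk_def)

lemma pcas_layer_walk: "pcas (i, x) (layer_walk i p) (j, y) \<longleftrightarrow> i = j \<and> pcas x p y"
  by (induction p arbitrary: x) (auto simp: layer_walk_def)

lemma pawalk_verts_layer_walk:
  "pawalk_verts (i, x) (layer_walk i p) = map (Pair i) (pawalk_verts x p)"
  by (induction p arbitrary: x) (auto simp: layer_walk_def)

lemma awalk_layer_walk:
  assumes "i \<in> pverts K" "pre_digraph.awalk (with_proj G) x p y"
  shows "pre_digraph.awalk (with_proj (K \<box> G)) (i, x) (layer_walk i p) (i, y)"
  using assms
  by (auto simp: awalk_with_proj_iff pcas_layer_walk pverts_cartesian_product)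
    (auto simp: layer_walk_def parcs_cartesian_product_iff)

text \<open>The final disjunction drives both bounds: either some arc changes the layer and is lost
  in the projection, or the walk stays in layer \<open>i\<close> and is recovered by
  lifting.\<close>

lemma pcas_proj_walk:
  assumes "pair_loopfree_digraph K"
    and "set p \<subseteq> parcs (K \<box> G)" "pcas (i, x) p (j, y)"
  shows "set (proj_walk p) \<subseteq> parcs G \<and> pcas x (proj_walk p) y \<and>
    (length (proj_walk p) < length p \<or> i = j \<and> p = layer_walk i (proj_walk p))"
  using assms(2,3)
proof (induction p arbitrary: i x)
  case Nil
  then show ?case by (simp add: proj_walk_def layer_walk_def)
next
  case (Cons e p)
  obtain i' x' where e: "e = ((i, x), (i', x'))"
    using Cons.prems(2) by (cases e) auto
  have IH: "set (proj_walk p) \<subseteq> parcs G \<and> pcas x' (proj_walk p) y \<and>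
    (length (proj_walk p) < length p \<or> i' = j \<and> p = layer_walk i' (proj_walk p))"
    using Cons.IH[of i' x'] Cons.prems e by simp
  show ?case
  proof (cases "i = i'")
    case True
    \<comment> \<open>As \<open>K\<close> has no loops, an arc that stays in its layer must come
      from \<open>G\<close>.\<close>
    then have "(x, x') \<in> parcs G"
      using Cons.prems(1) e pair_loopfree_digraph.no_loops'[OF assms(1)]
      by (auto simp: parcs_cartesian_product_iff)
    moreover have "proj_walk (e # p) = (x, x') # proj_walk p"
      using e True by (simp add: proj_walk_def)
    ultimately show ?thesis
      using IH e True by (auto simp: layer_walk_def)
  next
    case False
    then have "x = x'" "proj_walk (e # p) = proj_walk p"
      using Cons.prems(1) e by (auto simp: parcs_cartesian_product_iff proj_walk_def)
    then show ?thesis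
      using IH length_proj_walk_le[of p] by (simp add: less_Suc_eq_le)
  qed
qed

section \<open>Shortest paths and visibility in the product\<close>

context
  fixes K :: "'b pair_pre_digraph" and G :: "'a pair_pre_digraph"
  assumes K: "pair_graph K" and G: "pair_graph G"
begin

interpretation K: pair_graph K by (fact K)
interpretation G: pair_graph G by (fact G)
interpretation KG: pair_graph "K \<box> G" using K G by (rule pair_graph_cartesian_product)

lemma awalk_proj_walk:
  assumes "pre_digraph.awalk (with_proj (K \<box> G)) (i, x) p (j, y)"
  shows "pre_digraph.awalk (with_proj G) x (proj_walk p) y"
    and "length (proj_walk p) < length p \<or> i = j \<and> p = layer_walk i (proj_walk p)"
  using assms pcas_proj_walk[OF K.pair_loopfree_digraph_axioms, of p G i x j y]
  by (auto simp: awalk_with_proj_iff pverts_cartesian_product)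

text \<open>If a shortest path left layer \<open>i\<close>, its projection would be strictly
  shorter, and lifting that back to the layer would contradict minimality.\<close>

lemma shortest_path_layer_walk_iff:
  assumes "i \<in> pverts K"
  shows "shortest_path (K \<box> G) (i, x) p (i, y) \<longleftrightarrow>
    (\<exists>q. p = layer_walk i q \<and> shortest_path G x q y)"
proof
  assume p: "shortest_path (K \<box> G) (i, x) p (i, y)"
  then have walk: "KG.awalk (i, x) p (i, y)"
    by (simp add: shortest_path_iff KG.wf_digraph_axioms)
  have minimal: "length p \<le> length q" if "G.awalk x q y" for q
    using p awalk_layer_walk[OF assms that]
    by (metis length_layer_walk shortest_path_iff[OF KG.wf_digraph_axioms])
  have "p = layer_walk i (proj_walk p)"
    using awalk_proj_walk[OF walk] minimal by (meson linorder_not_less)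
  moreover have "shortest_path G x (proj_walk p) y"
    unfolding shortest_path_iff[OF G.wf_digraph_axioms]
    using awalk_proj_walk(1)[OF walk] minimal length_proj_walk_le[of p] by (meson order_trans)
  ultimately show "\<exists>q. p = layer_walk i q \<and> shortest_path G x q y" by blast
next
  assume "\<exists>q. p = layer_walk i q \<and> shortest_path G x q y"
  then obtain q where q: "p = layer_walk i q" "G.awalk x q y"
    "\<And>r. G.awalk x r y \<Longrightarrow> length q \<le> length r"
    by (auto simp: shortest_path_iff G.wf_digraph_axioms)
  have "length p \<le> length r" if "KG.awalk (i, x) r (i, y)" for r
    using q(1) q(3)[OF awalk_proj_walk(1)[OF that]] length_proj_walk_le[of r] by simp
  then show "shortest_path (K \<box> G) (i, x) p (i, y)"
    using q awalk_layer_walk[OF assms q(2)] by (simp add: shortest_path_iff KG.wf_digraph_axioms)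
qed

text \<open>Shortest paths inside a layer are exactly the lifted ones, so only the trace of
  \<open>X\<close> on the layer matters. One direction serves the upper bound, the other the pairs
  in a common layer for the lower bound.\<close>

lemma visible_layer_iff:
  assumes "i \<in> pverts K"
  shows "visible (K \<box> G) X (i, x) (i, y) \<longleftrightarrow> visible G {z. (i, z) \<in> X} x y"
proof -
  have inter: "set (pawalk_verts (i, x) (layer_walk i q)) \<inter> X = {(i, x), (i, y)} \<longleftrightarrow>
    set (pawalk_verts x q) \<inter> {z. (i, z) \<in> X} = {x, y}" (is "?L = _ \<longleftrightarrow> ?R = _") for q
  proof -
    have "?L = Pair i ` ?R"
      by (auto simp: pawalk_verts_layer_walk)
    then show ?thesis
      using inj_image_eq_iff[of "Pair i" ?R "{x, y}"] by (simp add: inj_def)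
  qed
  have "visible (K \<box> G) X (i, x) (i, y) \<longleftrightarrow>
    (\<exists>q. shortest_path G x q y \<and>
      set (pawalk_verts (i, x) (layer_walk i q)) \<inter> X = {(i, x), (i, y)})"
    unfolding visible_def shortest_path_layer_walk_iff[OF assms] awalk_verts_with_proj_eq by blast
  then show ?thesis
    by (simp only: inter visible_def awalk_verts_with_proj_eq)
qed

lemma mutual_visibility_set_layer:
  assumes "mutual_visibility_set (K \<box> G) X" "i \<in> pverts K"
  shows "mutual_visibility_set G {z. (i, z) \<in> X}"
proof -
  have "visible G {z. (i, z) \<in> X} x y" if "(i, x) \<in> X" "(i, y) \<in> X" "x \<noteq> y" for x y
    using that assms visible_layer_iff[OF assms(2), of X x y]
    unfolding mutual_visibility_set_def by blast
  moreover have "{z. (i, z) \<in> X} \<subseteq> pverts G"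
    using assms(1) by (auto simp: mutual_visibility_set_def pverts_cartesian_product)
  ultimately show ?thesis by (simp add: mutual_visibility_set_def)
qed

lemma visible_change_layer:
  assumes ij: "(i, j) \<in> parcs K"
    and vis: "visible G S x y"
    and indep: "independent_vertex_set G S" "x \<in> S" "y \<in> S"
  shows "visible (K \<box> G) (pverts K \<times> S) (i, x) (j, y)"
proof -
  have neq: "i \<noteq> j" and i: "i \<in> pverts K" and j: "j \<in> pverts K"
    using ij K.no_loops' K.in_arcsD1 K.in_arcsD2 by blast+
  have xG: "x \<in> pverts G"
    using indep by (auto simp: independent_vertex_set_def)
  obtain p where p: "shortest_path G x p y" "set (pawalk_verts x p) \<inter> S = {x, y}"
    using vis by (auto simp: visible_def awalk_verts_with_proj_eq)
  have p_min: "length p \<le> length q" if "G.awalk x q y" for q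
    using p(1) that by (simp add: shortest_path_iff G.wf_digraph_axioms)
  have p_path: "G.awalk x p y" "distinct (pawalk_verts x p)"
    using p(1) unfolding shortest_path_def G.apath_def by auto
  obtain r where r: "KG.awalk (i, x) r (j, y)" "length r = Suc (length p)"
    "set (pawalk_verts (i, x) r) \<inter> (pverts K \<times> S) = {(i, x), (j, y)}"
  \<comment> \<open>The empty path means \<open>x = y\<close>, where a single arc of
    \<open>K\<close> suffices.\<close>
  proof (cases p)
    case Nil
    then have "x = y" using p_path by (simp add: awalk_with_proj_iff)
    then show ?thesis
      using that[of "[((i, x), (j, x))]"] Nil xG ij i j indep
      by (auto simp: awalk_with_proj_iff pverts_cartesian_product parcs_cartesian_product_iff)
  next
    case (Cons e q)
    then obtain v where e: "e = (x, v)" "(x, v) \<in> parcs G" "set q \<subseteq> parcs G" "pcas v q y"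
      using p_path by (cases e) (auto simp: awalk_with_proj_iff)
    have vG: "v \<in> pverts G" using e G.in_arcsD2 by blast
    have v: "v \<notin> S"
      using indep e(2) by (auto simp: independent_vertex_set_def)
    \<comment> \<open>Distinctness keeps \<open>x\<close> out of the tail, so the tail meets
      \<open>S\<close> in \<open>y\<close> alone.\<close>
    have "x \<notin> set (pawalk_verts v q)"
      using p_path(2) Cons e by simp
    moreover have "y \<in> set (pawalk_verts v q)"
      using pawalk_verts_last[OF e(4)] .
    ultimately have q: "set (pawalk_verts v q) \<inter> S = {y}"
      using p(2) Cons e by auto
    \<comment> \<open>The layer is changed at \<open>v\<close>: since \<open>v \<notin> S\<close>,
      both of its copies avoid \<open>pverts K \<times> S\<close>.\<close>
    define r where "r = ((i, x), (i, v)) # ((i, v), (j, v)) # layer_walk j q"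
    have "KG.awalk (j, v) (layer_walk j q) (j, y)"
      using e vG by (intro awalk_layer_walk[OF j]) (simp add: awalk_with_proj_iff)
    then have "KG.awalk (i, x) r (j, y)"
      using e ij i xG vG
      by (simp add: awalk_with_proj_iff r_def pverts_cartesian_product parcs_cartesian_product_iff)
    moreover have "set (pawalk_verts (i, x) r) \<inter> (pverts K \<times> S) = {(i, x), (j, y)}"
      using q v i j indep by (auto simp: r_def pawalk_verts_layer_walk)
    ultimately show ?thesis
      using that[of r] Cons by (simp add: r_def)
  qed
  \<comment> \<open>Since \<open>i \<noteq> j\<close>, projecting \<open>q\<close> loses at least
    one arc, and what remains is no shorter than \<open>p\<close>.\<close>
  have "Suc (length p) \<le> length q" if "KG.awalk (i, x) q (j, y)" for q
    using awalk_proj_walk[OF that] neq p_min by (meson Suc_leI le_less_trans)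
  then have "shortest_path (K \<box> G) (i, x) r (j, y)"
    using r by (simp add: shortest_path_iff KG.wf_digraph_axioms)
  then show ?thesis
    using r(3) by (auto simp: visible_def awalk_verts_with_proj_eq)
qed

text \<open>Mutual visibility concerns distinct vertices only; the trivial case is needed for two
  copies of one vertex in different layers.\<close>

lemma visible_refl:
  assumes "x \<in> S" "x \<in> pverts G"
  shows "visible G S x x"
  unfolding visible_def using assms
  by (intro exI[of _ "[]"]) (simp add: shortest_path_iff G.wf_digraph_axioms awalk_with_proj_iff)

lemma mutual_visibility_set_Times:
  assumes complete: "\<And>i j. i \<in> pverts K \<Longrightarrow> j \<in> pverts K \<Longrightarrow> i \<noteq> j \<Longrightarrow> (i, j) \<in> parcs K"
    and S: "mutual_visibility_set G S" "independent_vertex_set G S"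
  shows "mutual_visibility_set (K \<box> G) (pverts K \<times> S)"
proof -
  have vis: "visible G S x y" if "x \<in> S" "y \<in> S" for x y
    using that S visible_refl by (cases "x = y") (auto simp: mutual_visibility_set_def)
  have "visible (K \<box> G) (pverts K \<times> S) (i, x) (j, y)"
    if "i \<in> pverts K" "j \<in> pverts K" "x \<in> S" "y \<in> S" for i j x y
  proof (cases "i = j")
    case True
    then show ?thesis using that vis[of x y] visible_layer_iff[of i "pverts K \<times> S" x y] by simp
  next
    case False
    then show ?thesis using that vis complete S visible_change_layer by simp
  qed
  then show ?thesis
    using S by (auto simp: mutual_visibility_set_def pverts_cartesian_product)
qed

end

section \<open>The mutual-visibility number of a product with a complete graph\<close>

text \<open>Supplies the finiteness that \<open>Max\<close> requires in both visibility
  numbers.\<close>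

lemma finite_card_subsets:
  assumes "finite V" "\<And>X. P X \<Longrightarrow> X \<subseteq> V"
  shows "finite {card X |X. P X}"
proof -
  have "finite {X. P X}"
    using assms by (auto intro: finite_subset[of _ "Pow V"])
  then show ?thesis by simp
qed

lemma card_le_mutual_visibility_number:
  assumes "finite (pverts G)" "mutual_visibility_set G X"
  shows "card X \<le> mutual_visibility_number G"
  unfolding mutual_visibility_number_def using assms
  by (intro Max_ge finite_card_subsets[OF assms(1)]) (auto simp: mutual_visibility_set_def)

lemma mutual_visibility_number_attained:
  assumes "finite (pverts G)"
  obtains X where "mutual_visibility_set G X" "card X = mutual_visibility_number G"
proof -
  have "mutual_visibility_number G \<in> {card X |X. mutual_visibility_set G X}"
    unfolding mutual_visibility_number_def
  proof (rule Max_in)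
    show "finite {card X |X. mutual_visibility_set G X}"
      by (rule finite_card_subsets[OF assms]) (simp add: mutual_visibility_set_def)
    show "{card X |X. mutual_visibility_set G X} \<noteq> {}"
      by (auto intro: exI[of _ "{}"] simp: mutual_visibility_set_def)
  qed
  then show ?thesis using that by auto
qed

lemma independent_mutual_visibility_number_attained:
  assumes "finite (pverts G)"
  obtains X where "mutual_visibility_set G X" "independent_vertex_set G X"
    "card X = independent_mutual_visibility_number G"
proof -
  have "independent_mutual_visibility_number G
      \<in> {card X |X. mutual_visibility_set G X \<and> independent_vertex_set G X}"
    unfolding independent_mutual_visibility_number_def
  proof (rule Max_in)
    show "finite {card X |X. mutual_visibility_set G X \<and> independent_vertex_set G X}"
      by (rule finite_card_subsets[OF assms]) (simp add: mutual_visibility_set_def)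
    show "{card X |X. mutual_visibility_set G X \<and> independent_vertex_set G X} \<noteq> {}"
      by (auto intro: exI[of _ "{}"] simp: mutual_visibility_set_def independent_vertex_set_def)
  qed
  then show ?thesis using that by auto
qed

text \<open>A maximum set is split into its traces on the layers, each of which is a
  mutual-visibility set of \<open>G\<close>.\<close>

lemma mutual_visibility_number_cartesian_product_le:
  assumes K: "pair_graph K" and G: "pair_graph G"
  shows "mutual_visibility_number (K \<box> G) \<le> card (pverts K) * mutual_visibility_number G"
proof -
  interpret K: pair_graph K by fact
  interpret G: pair_graph G by fact
  obtain X where X: "mutual_visibility_set (K \<box> G) X" "card X = mutual_visibility_number (K \<box> G)"
    using mutual_visibility_number_attained[of "K \<box> G"] by (auto simp: pverts_cartesian_product)
  have sub: "X \<subseteq> pverts K \<times> pverts G"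
    using X by (simp add: mutual_visibility_set_def pverts_cartesian_product)
  have "finite {z. (i, z) \<in> X}" for i
    using sub by (auto intro: finite_subset[of _ "pverts G"])
  then have "card (SIGMA i:pverts K. {z. (i, z) \<in> X}) = (\<Sum>i\<in>pverts K. card {z. (i, z) \<in> X})"
    by (intro card_SigmaI) auto
  moreover have "(SIGMA i:pverts K. {z. (i, z) \<in> X}) = X"
    using sub by auto
  ultimately have "card X = (\<Sum>i\<in>pverts K. card {z. (i, z) \<in> X})"
    by simp
  also have "\<dots> \<le> (\<Sum>i\<in>pverts K. mutual_visibility_number G)"
    using mutual_visibility_set_layer[OF K G X(1)]
    by (intro sum_mono card_le_mutual_visibility_number) auto
  finally show ?thesis using X by simp
qed

theorem theorem3p4:
  fixes G :: "'a pair_pre_digraph" and K :: "'b pair_pre_digraph" and k :: nat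
  assumes "k \<ge> 2"
    and "pair_graph K" and "complete_digraph k (with_proj K)"
    and "pair_graph G" and "connected (with_proj G)"
    and "mutual_visibility_number G = independent_mutual_visibility_number G"
  shows "mutual_visibility_number (K \<box> G) = k * mutual_visibility_number G"
proof (rule antisym)
  interpret K: pair_graph K by fact
  interpret G: pair_graph G by fact
  have K: "card (pverts K) = k"
    "\<And>i j. i \<in> pverts K \<Longrightarrow> j \<in> pverts K \<Longrightarrow> i \<noteq> j \<Longrightarrow> (i, j) \<in> parcs K"
    using assms(3) by (auto simp: complete_digraph_pair_def)
  show "mutual_visibility_number (K \<box> G) \<le> k * mutual_visibility_number G"
    using mutual_visibility_number_cartesian_product_le[OF assms(2,4)] K(1) by simp
  \<comment> \<open>The assumed equality of the two numbers makes a largest independent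
    mutual-visibility set also a largest one overall.\<close>
  obtain S where S: "mutual_visibility_set G S" "independent_vertex_set G S"
    "card S = mutual_visibility_number G"
    using independent_mutual_visibility_number_attained[of G] assms(6) by auto
  have "mutual_visibility_set (K \<box> G) (pverts K \<times> S)"
    using mutual_visibility_set_Times[OF assms(2,4) K(2) S(1,2)] .
  then have "card (pverts K \<times> S) \<le> mutual_visibility_number (K \<box> G)"
    by (intro card_le_mutual_visibility_number) (auto simp: pverts_cartesian_product)
  then show "k * mutual_visibility_number G \<le> mutual_visibility_number (K \<box> G)"
    using K(1) S(3) by (simp add: card_cartesian_product)
qed

end
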